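(* Let $X$, $Y$ and $Z$ be any random variables defined on a probability space $(\Omega, \mathcal{F}, P)$. Then $$E[X - E(X \mid Y, Z)]^2 \leq \min\left\{ E[X - E(X \mid Y)]^2,\ E[X - E(X \mid Z)]^2 \right\}.$$
   Context: $E(X \mid Y)$, $E(X\mid Z)$ and $E(X \mid Y, Z)$ denote the conditional expectations of $X$ given the sigma-algebras generated by $Y$, by $Z$, and by $(Y,Z)$, respectively. The notation $E[\cdot]^2$ means the expectation of the square. *)

theory Defs
  imports "HOL-Probability.Probability"
begin

text \<open>
  The conditioning sigma-algebra is the one generated by V. No integrability of X is built in: where
  the conditional expectation of its absolute value is infinite, \<open>real_cond_exp\<close> takes some finite value.
  If that happens with positive probability, the mean square of the difference of X and any finite
  function measurable for that sigma-algebra is infinite, so this value is immaterial.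
\<close>

definition cond_expect_given ::
    "'a measure \<Rightarrow> ('a \<Rightarrow> real) \<Rightarrow> 'b measure \<Rightarrow> ('a \<Rightarrow> 'b) \<Rightarrow> 'a \<Rightarrow> real" where
  "cond_expect_given M X N V = real_cond_exp M (vimage_algebra (space M) V N) X"

text \<open>
  The second moment is taken in the extended nonnegative reals, so that it is infinite (and not 0, as
  for the Bochner integral) when the square is not integrable.
\<close>

definition mean_square :: "'a measure \<Rightarrow> ('a \<Rightarrow> real) \<Rightarrow> ennreal" where
  "mean_square M W = (\<integral>\<^sup>+ \<omega>. ennreal ((W \<omega>)\<^sup>2) \<partial>M)"

end

theory Submission
  imports Defs
begin

text \<open>
  For a sub-sigma-algebra F, the conditional expectation given F has the smallest mean square
  distance to X among all F-measurable functions h: if D = X - h is square integrable, then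
  E(X | F) = h + E(D | F), and X - E(X | F) = D - E(D | F) has second moment E D^2 - E (E(D | F))^2.
  The theorem is the case F = sigma(Y, Z), with h = E(X | Y) or h = E(X | Z).
\<close>

text \<open>Pythagoras in L2: the residual is orthogonal to \<open>E(D | F)\<close>, so the cross
  term in the expanded square reduces to the second moment of \<open>E(D | F)\<close>.\<close>

lemma (in finite_measure_subalgebra) integral_square_diff_real_cond_exp:
  fixes D :: "'a \<Rightarrow> real"
  assumes [measurable]: "D \<in> borel_measurable M"
    and D2: "integrable M (\<lambda>x. (D x)\<^sup>2)"
  shows "integrable M (\<lambda>x. (D x - real_cond_exp M F D x)\<^sup>2)"
    and "(\<integral>x. (D x - real_cond_exp M F D x)\<^sup>2 \<partial>M)
           = (\<integral>x. (D x)\<^sup>2 \<partial>M) - (\<integral>x. (real_cond_exp M F D x)\<^sup>2 \<partial>M)"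
proof -
  define E where "E = real_cond_exp M F D"
  have [measurable]: "E \<in> borel_measurable M" and E_F: "E \<in> borel_measurable F"
    by (simp_all add: E_def)
  have D1: "integrable M D"
    by (rule square_integrable_imp_integrable) (use D2 in auto)
  \<comment> \<open>Conditional Jensen for the convex squaring function: its integrability along
    \<open>D\<close> passes to \<open>E\<close>.\<close>
  have E2: "integrable M (\<lambda>x. (E x)\<^sup>2)"
    unfolding E_def
    by (rule integrable_convex_cond_exp[where I = UNIV]) (use D1 D2 convex_power2 in auto)
  have ED: "integrable M (\<lambda>x. E x * D x)"
  proof (rule Bochner_Integration.integrable_bound)
    show "integrable M (\<lambda>x. (E x)\<^sup>2 + (D x)\<^sup>2)"
      using E2 D2 by simp
    have "norm (E x * D x) \<le> norm ((E x)\<^sup>2 + (D x)\<^sup>2)" for x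
    proof -
      have "2 * \<bar>E x * D x\<bar> \<le> (E x)\<^sup>2 + (D x)\<^sup>2"
        using sum_squares_bound[of "\<bar>E x\<bar>" "\<bar>D x\<bar>"] by (simp add: abs_mult)
      then show ?thesis
        using abs_ge_zero[of "E x * D x"] unfolding real_norm_def by linarith
    qed
    then show "AE x in M. norm (E x * D x) \<le> norm ((E x)\<^sup>2 + (D x)\<^sup>2)"
      by simp
  qed simp
  \<comment> \<open>Defining property of the conditional expectation, tested against the
    \<open>F\<close>-measurable function \<open>E\<close> itself; \<open>ED\<close> makes this test
    function admissible.\<close>
  have orth: "(\<integral>x. E x * D x \<partial>M) = (\<integral>x. (E x)\<^sup>2 \<partial>M)"
    using real_cond_exp_intg(2)[OF ED E_F] by (simp add: E_def power2_eq_square)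
  have expand: "(D x - E x)\<^sup>2 = (D x)\<^sup>2 - 2 * (E x * D x) + (E x)\<^sup>2" for x
    by (simp add: power2_diff)
  show "integrable M (\<lambda>x. (D x - real_cond_exp M F D x)\<^sup>2)"
    using D2 E2 ED by (simp add: expand flip: E_def)
  show "(\<integral>x. (D x - real_cond_exp M F D x)\<^sup>2 \<partial>M)
      = (\<integral>x. (D x)\<^sup>2 \<partial>M) - (\<integral>x. (real_cond_exp M F D x)\<^sup>2 \<partial>M)"
    using D2 E2 ED by (simp add: expand orth flip: E_def)
qed

text \<open>Additivity of conditional expectations is available for integrable summands, whereas
  here only the difference \<open>X - h\<close> is integrable. The identity is therefore proved with
  a factor \<open>w\<close>, which is cancelled at the end.\<close>

lemma (in finite_measure_subalgebra) real_cond_exp_shift: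
  fixes X h :: "'a \<Rightarrow> real"
  assumes X: "X \<in> borel_measurable M" and h: "h \<in> borel_measurable F"
    and D: "integrable M (\<lambda>x. X x - h x)"
  shows "AE x in M. real_cond_exp M F X x = h x + real_cond_exp M F (\<lambda>x. X x - h x) x"
proof -
  \<comment> \<open>X and h need not be integrable; the positive weight w makes w X and w h integrable.\<close>
  define w where "w x = 1 / (1 + \<bar>h x\<bar>)" for x
  note [measurable] = X
  have h_M [measurable]: "h \<in> borel_measurable M"
    by (rule measurable_from_subalg[OF subalg h])
  have w_F: "w \<in> borel_measurable F"
    unfolding w_def using h by measurable
  have w_M [measurable]: "w \<in> borel_measurable M"
    by (rule measurable_from_subalg[OF subalg w_F])
  have w_pos: "0 < w x" and w_le: "w x \<le> 1" and wh_le: "\<bar>w x * h x\<bar> \<le> 1" for x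
    by (auto simp: w_def abs_mult)
  have wh_F: "(\<lambda>x. w x * h x) \<in> borel_measurable F"
    using w_F h by measurable
  have wh: "integrable M (\<lambda>x. w x * h x)"
    by (rule integrable_const_bound[where B = 1]) (use wh_le in auto)
  have wD: "integrable M (\<lambda>x. w x * (X x - h x))"
  proof (rule Bochner_Integration.integrable_bound[OF D])
    have "norm (w x * (X x - h x)) \<le> norm (X x - h x)" for x
      using w_pos[of x] w_le[of x] by (simp add: abs_mult mult_left_le_one_le)
    then show "AE x in M. norm (w x * (X x - h x)) \<le> norm (X x - h x)"
      by simp
  qed simp
  have split: "(\<lambda>x. w x * X x) = (\<lambda>x. w x * h x + w x * (X x - h x))"
    by (simp add: algebra_simps)
  have wX: "integrable M (\<lambda>x. w x * X x)"
    unfolding split using wh wD by (rule Bochner_Integration.integrable_add)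
  \<comment> \<open>Pulling out \<open>w\<close> asks integrability only of the product
    \<open>w X\<close>, so it reaches a non-integrable \<open>X\<close>.\<close>
  have "AE x in M. real_cond_exp M F (\<lambda>x. w x * X x) x = w x * real_cond_exp M F X x"
    using w_F X wX by (rule real_cond_exp_mult)
  moreover have "AE x in M. real_cond_exp M F (\<lambda>x. w x * X x) x
      = real_cond_exp M F (\<lambda>x. w x * h x) x + real_cond_exp M F (\<lambda>x. w x * (X x - h x)) x"
    unfolding split using wh wD by (rule real_cond_exp_add)
  moreover have "AE x in M. real_cond_exp M F (\<lambda>x. w x * h x) x = w x * h x"
    using wh wh_F by (rule real_cond_exp_F_meas)
  moreover have "AE x in M. real_cond_exp M F (\<lambda>x. w x * (X x - h x)) x
      = w x * real_cond_exp M F (\<lambda>x. X x - h x) x"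
    by (rule real_cond_exp_mult) (use w_F wD in auto)
  ultimately show ?thesis
  proof eventually_elim
    case (elim x)
    then have "w x * real_cond_exp M F X x
        = w x * (h x + real_cond_exp M F (\<lambda>x. X x - h x) x)"
      by (simp add: distrib_left)
    then show ?case
      using w_pos[of x] by simp
  qed
qed

lemma (in finite_measure_subalgebra) mean_square_real_cond_exp_le:
  fixes X h :: "'a \<Rightarrow> real"
  assumes X: "X \<in> borel_measurable M" and h: "h \<in> borel_measurable F"
  shows "mean_square M (\<lambda>x. X x - real_cond_exp M F X x) \<le> mean_square M (\<lambda>x. X x - h x)"
\<comment> \<open>An infinite right-hand side leaves nothing to prove; a finite one makes
  \<open>X - h\<close> square integrable, hence integrable, as the shift requires.\<close>
proof (cases "mean_square M (\<lambda>x. X x - h x) = \<infinity>")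
  case False
  note [measurable] = X measurable_from_subalg[OF subalg h]
  define D where "D = (\<lambda>x. X x - h x)"
  have D_meas [measurable]: "D \<in> borel_measurable M"
    unfolding D_def by measurable
  have D2: "integrable M (\<lambda>x. (D x)\<^sup>2)"
    by (rule integrableI_bounded) (use False in \<open>auto simp: D_def mean_square_def less_top\<close>)
  have "integrable M (\<lambda>x. X x - h x)"
    using square_integrable_imp_integrable[OF D_meas D2] by (simp add: D_def)
  then have shift: "AE x in M. real_cond_exp M F X x = h x + real_cond_exp M F D x"
    unfolding D_def by (rule real_cond_exp_shift[OF X h])
  have "mean_square M (\<lambda>x. X x - real_cond_exp M F X x)
      = (\<integral>\<^sup>+x. ennreal ((D x - real_cond_exp M F D x)\<^sup>2) \<partial>M)"
    unfolding mean_square_def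
    by (intro nn_integral_cong_AE, use shift in eventually_elim) (simp add: D_def diff_diff_add)
  also have "\<dots> = ennreal (\<integral>x. (D x - real_cond_exp M F D x)\<^sup>2 \<partial>M)"
    by (intro nn_integral_eq_integral integral_square_diff_real_cond_exp D2) auto
  \<comment> \<open>The term dropped from the Pythagorean identity is the integral of a
    square.\<close>
  also have "\<dots> \<le> ennreal (\<integral>x. (D x)\<^sup>2 \<partial>M)"
    by (intro ennreal_leI) (simp add: integral_square_diff_real_cond_exp(2)[OF D_meas D2])
  also have "\<dots> = mean_square M (\<lambda>x. X x - h x)"
    using nn_integral_eq_integral[OF D2] by (simp add: mean_square_def D_def)
  finally show ?thesis .
qed simp

text \<open>A function of \<open>V\<close> generates a coarser sigma-algebra than \<open>V\<close>,
  so the conditional expectation given \<open>g(V)\<close> is one of the competitors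
  \<open>h\<close> for conditioning on \<open>V\<close>.\<close>

lemma mean_square_cond_expect_given_le:
  fixes M :: "'a measure" and X :: "'a \<Rightarrow> real"
  assumes "finite_measure M" and X: "X \<in> borel_measurable M" and V: "V \<in> M \<rightarrow>\<^sub>M N"
    and g: "g \<in> N \<rightarrow>\<^sub>M K"
  shows "mean_square M (\<lambda>\<omega>. X \<omega> - cond_expect_given M X N V \<omega>)
      \<le> mean_square M (\<lambda>\<omega>. X \<omega> - cond_expect_given M X K (\<lambda>\<omega>. g (V \<omega>)) \<omega>)"
proof -
  let ?F = "vimage_algebra (space M) V N"
  let ?G = "vimage_algebra (space M) (\<lambda>\<omega>. g (V \<omega>)) K"
  interpret finite_measure M by fact
  interpret finite_measure_subalgebra M ?F
    by standard (simp add: subalgebra_def sets_image_in_sets[OF refl V])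
  have "V \<in> ?F \<rightarrow>\<^sub>M N"
    using measurable_space[OF V] by (intro measurable_vimage_algebra1) auto
  then have gV: "(\<lambda>\<omega>. g (V \<omega>)) \<in> ?F \<rightarrow>\<^sub>M K"
    using g by measurable
  have "subalgebra ?F ?G"
    using sets_image_in_sets[OF space_vimage_algebra gV] by (simp add: subalgebra_def)
  \<comment> \<open>\<open>real_cond_exp\<close> is always measurable for its conditioning
    sigma-algebra, whether or not \<open>X\<close> is integrable.\<close>
  then have "real_cond_exp M ?G X \<in> borel_measurable ?F"
    by (rule measurable_from_subalg) simp
  then show ?thesis
    unfolding cond_expect_given_def by (rule mean_square_real_cond_exp_le[OF X])
qed

theorem theorem4:
  fixes M :: "'a measure" and X Y Z :: "'a \<Rightarrow> real"
  assumes "prob_space M"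
    and "X \<in> borel_measurable M"
    and "Y \<in> borel_measurable M"
    and "Z \<in> borel_measurable M"
  shows "mean_square M (\<lambda>\<omega>. X \<omega> -
            cond_expect_given M X (borel \<Otimes>\<^sub>M borel) (\<lambda>\<omega>. (Y \<omega>, Z \<omega>)) \<omega>)
         \<le> min (mean_square M (\<lambda>\<omega>. X \<omega> - cond_expect_given M X borel Y \<omega>))
               (mean_square M (\<lambda>\<omega>. X \<omega> - cond_expect_given M X borel Z \<omega>))"
proof -
  interpret prob_space M by fact
  have YZ: "(\<lambda>\<omega>. (Y \<omega>, Z \<omega>)) \<in> M \<rightarrow>\<^sub>M borel \<Otimes>\<^sub>M borel"
    using assms(3,4) by measurable
  note le = mean_square_cond_expect_given_le[OF finite_measure_axioms assms(2) YZ]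
  show ?thesis
    \<comment> \<open>The projections play the role of \<open>g\<close>: they recover
      \<open>Y\<close> and \<open>Z\<close> from the pair.\<close>
    using le[OF measurable_fst] le[OF measurable_snd] by simp
qed

end
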